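(* Let $\Bbbk$ be an algebraically closed field of characteristic zero and $\Lambda_2(\Bbbk)=\Bbbk\langle x,y:yx=xy+y^2\rangle$ the Jordanian plane. Let $w=x^my^n$ with integers $m,n\ge0$, and let $\delta=\mathrm{ad}_w$ be the inner derivation $\delta(a)=wa-aw$. Then: (1) If $m=n=0$, then $\delta=0$ and $\mathrm{Aut}_\delta(\Lambda_2(\Bbbk))=\mathrm{Aut}(\Lambda_2(\Bbbk))$. (2) If $m=0$ and $n>0$, then $\mathrm{Aut}_\delta(\Lambda_2(\Bbbk))=\{\varphi_{\gamma,g} : \gamma^n=1,\ g(y)\in\Bbbk[y]\}$. (3) If $m=1$ and $n=0$, then $\mathrm{Aut}_\delta(\Lambda_2(\Bbbk))=\{\varphi_{1,c} : c\in\Bbbk\}$. (4) If $m\ge1$ and $(m,n)\ne(1,0)$, then $\mathrm{Aut}_\delta(\Lambda_2(\Bbbk))=\{\varphi_{\gamma,0} : \gamma^{m+n}=1\}$.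
   Context: For $\gamma\in\Bbbk^*$ and $g(y)\in\Bbbk[y]$, $\varphi_{\gamma,g}$ denotes the $\Bbbk$-algebra automorphism of $\Lambda_2(\Bbbk)$ with $\varphi_{\gamma,g}(x)=\gamma x+g(y)$, $\varphi_{\gamma,g}(y)=\gamma y$; known fact: every automorphism of $\Lambda_2(\Bbbk)$ is of this form. For a derivation $\delta$, the isotropy group is $\mathrm{Aut}_\delta(\Lambda_2(\Bbbk))=\{\rho\in\mathrm{Aut}(\Lambda_2(\Bbbk)):\rho\delta=\delta\rho\}$. *)

theory Defs
  imports "HOL-Library.Poly_Mapping" "HOL-Computational_Algebra.Polynomial"
begin

datatype gen = GX | GY

datatype word = Word "gen list"

text \<open>The free monoid on two letters, written additively: \<^typ>\<open>word \<Rightarrow>\<^sub>0 'k\<close> with its convolution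
  product is then the free associative algebra on two generators.\<close>

instantiation word :: monoid_add
begin

definition zero_word :: word where "0 = Word []"

fun plus_word :: "word \<Rightarrow> word \<Rightarrow> word" where "Word u + Word v = Word (u @ v)"

instance
proof
  fix a b c :: word
  show "a + b + c = a + (b + c)" by (cases a; cases b; cases c) simp
  show "0 + a = a" "a + 0 = a" by (cases a; simp add: zero_word_def)+
qed

end

type_synonym 'k free_algebra = "word \<Rightarrow>\<^sub>0 'k"

definition free_gen :: "gen \<Rightarrow> 'k::field free_algebra" where
  "free_gen s = Poly_Mapping.single (Word [s]) 1"

abbreviation (input) free_const :: "'k \<Rightarrow> 'k::field free_algebra" where
  "free_const c \<equiv> Poly_Mapping.single 0 c"

text \<open>The two-sided ideal generated by $yx - xy - y^2$.\<close>

inductive_set jordan_ideal :: "'k::field free_algebra set" where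
  rel: "free_gen GY * free_gen GX - (free_gen GX * free_gen GY + free_gen GY ^ 2) \<in> jordan_ideal"
| zero: "0 \<in> jordan_ideal"
| add: "a \<in> jordan_ideal \<Longrightarrow> b \<in> jordan_ideal \<Longrightarrow> a + b \<in> jordan_ideal"
| left: "a \<in> jordan_ideal \<Longrightarrow> r * a \<in> jordan_ideal"
| right: "a \<in> jordan_ideal \<Longrightarrow> a * r \<in> jordan_ideal"

lemma jordan_ideal_uminus: "a \<in> jordan_ideal \<Longrightarrow> - a \<in> jordan_ideal"
  using jordan_ideal.left[of a "- 1"] by simp

lemma jordan_ideal_diff: "a \<in> jordan_ideal \<Longrightarrow> b \<in> jordan_ideal \<Longrightarrow> a - b \<in> jordan_ideal"
  using jordan_ideal.add[OF _ jordan_ideal_uminus, of a b] by simp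

lemma word_add_eq_0_iff: "(a::word) + b = 0 \<longleftrightarrow> a = 0 \<and> b = 0"
  by (cases a; cases b) (simp add: zero_word_def)

lemma lookup_mult_0:
  "Poly_Mapping.lookup (f * g) (0::word)
     = Poly_Mapping.lookup f 0 * Poly_Mapping.lookup (g :: 'k::field free_algebra) 0"
proof -
  have "(\<Sum>q. Poly_Mapping.lookup g q when 0 = l + q) = (Poly_Mapping.lookup g 0 when l = 0)" for l
  proof -
    have "(\<lambda>q. Poly_Mapping.lookup g q when 0 = l + q)
        = (\<lambda>q. (Poly_Mapping.lookup g q when l = 0) when q = 0)"
      using word_add_eq_0_iff[of l] by (auto simp: fun_eq_iff when_def eq_commute[of 0])
    then show ?thesis by (simp only: Sum_any_when_equal)
  qed
  then show ?thesis
    by (simp only: lookup_mult mult_when Sum_any_when_equal)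
qed

lemma lookup_free_gen_0: "Poly_Mapping.lookup (free_gen s) 0 = 0"
  by (simp add: free_gen_def zero_word_def lookup_single)

lemma jordan_ideal_lookup_0: "a \<in> jordan_ideal \<Longrightarrow> Poly_Mapping.lookup a 0 = 0"
  by (induction rule: jordan_ideal.induct)
     (simp_all add: lookup_mult_0 lookup_add lookup_minus power2_eq_square
        lookup_free_gen_0)

definition jordan_rel :: "'k::field free_algebra \<Rightarrow> 'k free_algebra \<Rightarrow> bool" where
  "jordan_rel a b \<longleftrightarrow> a - b \<in> jordan_ideal"

lemma equivp_jordan_rel: "equivp jordan_rel"
proof (rule equivpI)
  show "reflp jordan_rel" by (simp add: reflp_def jordan_rel_def jordan_ideal.zero)
  show "symp jordan_rel"
    unfolding symp_def jordan_rel_def using jordan_ideal_uminus by fastforce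
  show "transp jordan_rel"
    unfolding transp_def jordan_rel_def using jordan_ideal.add by fastforce
qed

quotient_type (overloaded) 'k jordanian_plane = "'k::field free_algebra" / jordan_rel
  by (rule equivp_jordan_rel)

instantiation jordanian_plane :: (field) ring_1
begin

lift_definition zero_jordanian_plane :: "'a jordanian_plane" is 0 .
lift_definition one_jordanian_plane :: "'a jordanian_plane" is 1 .

lift_definition plus_jordanian_plane ::
    "'a jordanian_plane \<Rightarrow> 'a jordanian_plane \<Rightarrow> 'a jordanian_plane" is "(+)"
  unfolding jordan_rel_def by (metis add_diff_add jordan_ideal.add)

lift_definition minus_jordanian_plane ::
    "'a jordanian_plane \<Rightarrow> 'a jordanian_plane \<Rightarrow> 'a jordanian_plane" is "(-)"
proof -
  fix a b c d :: "'a free_algebra"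
  assume "jordan_rel a b" "jordan_rel c d"
  then have "(a - b) - (c - d) \<in> jordan_ideal"
    unfolding jordan_rel_def by (rule jordan_ideal_diff)
  then show "jordan_rel (a - c) (b - d)"
    unfolding jordan_rel_def by (simp add: algebra_simps)
qed

lift_definition uminus_jordanian_plane ::
    "'a jordanian_plane \<Rightarrow> 'a jordanian_plane" is uminus
proof -
  fix a b :: "'a free_algebra"
  assume "jordan_rel a b"
  then have "- (a - b) \<in> jordan_ideal"
    unfolding jordan_rel_def by (rule jordan_ideal_uminus)
  then show "jordan_rel (- a) (- b)"
    unfolding jordan_rel_def by simp
qed

lift_definition times_jordanian_plane ::
    "'a jordanian_plane \<Rightarrow> 'a jordanian_plane \<Rightarrow> 'a jordanian_plane" is "(*)"
proof -
  fix a b c d :: "'a free_algebra"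
  assume "jordan_rel a b" "jordan_rel c d"
  then have "a * (c - d) + (a - b) * d \<in> jordan_ideal"
    unfolding jordan_rel_def by (intro jordan_ideal.add jordan_ideal.left jordan_ideal.right)
  then show "jordan_rel (a * c) (b * d)"
    unfolding jordan_rel_def by (simp add: algebra_simps)
qed

instance
proof
  fix a b c :: "'a jordanian_plane"
  have eq: "jordan_rel f g" if "f = g" for f g :: "'a free_algebra"
    using that equivp_reflp[OF equivp_jordan_rel] by simp
  show "a + b + c = a + (b + c)" by transfer (rule eq, simp add: algebra_simps)
  show "a + b = b + a" by transfer (rule eq, simp add: algebra_simps)
  show "0 + a = a" by transfer (rule eq, simp)
  show "- a + a = 0" by transfer (rule eq, simp)
  show "a - b = a + - b" by transfer (rule eq, simp)
  show "a * b * c = a * (b * c)" by transfer (rule eq, simp add: algebra_simps)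
  show "(a + b) * c = a * c + b * c" by transfer (rule eq, simp add: algebra_simps)
  show "a * (b + c) = a * b + a * c" by transfer (rule eq, simp add: algebra_simps)
  show "1 * a = a" by transfer (rule eq, simp)
  show "a * 1 = a" by transfer (rule eq, simp)
  show "(0::'a jordanian_plane) \<noteq> 1"
  proof transfer
    show "\<not> jordan_rel (0::'a free_algebra) 1"
      using jordan_ideal_lookup_0[of "0 - 1 :: 'a free_algebra"]
      by (auto simp: jordan_rel_def lookup_minus)
  qed
qed

end

lift_definition jscale :: "'k::field \<Rightarrow> 'k jordanian_plane \<Rightarrow> 'k jordanian_plane"
  is "\<lambda>c a. free_const c * a"
  unfolding jordan_rel_def by (metis jordan_ideal.left right_diff_distrib)

lift_definition jX :: "'k::field jordanian_plane" is "free_gen GX" .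
lift_definition jY :: "'k::field jordanian_plane" is "free_gen GY" .

lemma jY_jX: "jY * jX = jX * jY + (jY::'k::field jordanian_plane) ^ 2"
  unfolding power2_eq_square
  by transfer (use jordan_ideal.rel in \<open>simp add: jordan_rel_def power2_eq_square\<close>)

lemma vector_space_jscale: "vector_space (jscale :: 'k::field \<Rightarrow> _)"
proof
  fix a b :: 'k and x y :: "'k jordanian_plane"
  have eq: "jordan_rel f g" if "f = g" for f g :: "'k free_algebra"
    using that equivp_reflp[OF equivp_jordan_rel] by simp
  show "jscale a (x + y) = jscale a x + jscale a y"
    by transfer (rule eq, simp add: algebra_simps)
  show "jscale (a + b) x = jscale a x + jscale b x"
    by transfer (rule eq, simp add: single_add algebra_simps)
  show "jscale a (jscale b x) = jscale (a * b) x"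
    by transfer (rule eq, simp add: mult_single flip: mult.assoc)
  show "jscale 1 x = x"
    by transfer (rule eq, simp)
qed

definition jalgebra_hom :: "('k::field jordanian_plane \<Rightarrow> 'k jordanian_plane) \<Rightarrow> bool" where
  "jalgebra_hom \<rho> \<longleftrightarrow> Vector_Spaces.linear jscale jscale \<rho> \<and> \<rho> 1 = 1 \<and> (\<forall>a b. \<rho> (a * b) = \<rho> a * \<rho> b)"

definition jaut :: "('k::field jordanian_plane \<Rightarrow> 'k jordanian_plane) set" where
  "jaut = {\<rho>. jalgebra_hom \<rho> \<and> bij \<rho>}"

definition isotropy ::
  "('k::field jordanian_plane \<Rightarrow> 'k jordanian_plane) \<Rightarrow> ('k jordanian_plane \<Rightarrow> 'k jordanian_plane) set"
  where "isotropy \<delta> = {\<rho> \<in> jaut. \<rho> \<circ> \<delta> = \<delta> \<circ> \<rho>}"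

definition ad :: "'k::field jordanian_plane \<Rightarrow> 'k jordanian_plane \<Rightarrow> 'k jordanian_plane" where
  "ad w a = w * a - a * w"

definition jeval :: "'k::field poly \<Rightarrow> 'k jordanian_plane \<Rightarrow> 'k jordanian_plane" where
  "jeval p b = (\<Sum>i\<le>degree p. jscale (coeff p i) (b ^ i))"

text \<open>Meaningful for \<open>\<gamma> \<noteq> 0\<close> only; see \<open>jphi_unique\<close> below.\<close>

definition jphi :: "'k::field \<Rightarrow> 'k poly \<Rightarrow> 'k jordanian_plane \<Rightarrow> 'k jordanian_plane" where
  "jphi \<gamma> g = (THE \<rho>. \<rho> \<in> jaut \<and> \<rho> jX = jscale \<gamma> jX + jeval g jY \<and> \<rho> jY = jscale \<gamma> jY)"


subsection \<open>Well-definedness of \<open>jphi\<close>\<close>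

lemma free_algebra_induct [case_names single add]:
  fixes a :: "'k::field free_algebra"
  assumes s: "\<And>w c. P (Poly_Mapping.single w c)" and p: "\<And>f g. P f \<Longrightarrow> P g \<Longrightarrow> P (f + g)"
  shows "P a"
proof (induction a rule: update_induct)
  case const
  then show ?case using s[of 0 0] by simp
next
  case (update f k v)
  have "Poly_Mapping.update k v f = f + Poly_Mapping.single k v"
    using update(1)
    by (intro poly_mapping_eqI) (auto simp: lookup_update lookup_add lookup_single when_def in_keys_iff)
  then show ?case using p[OF update(3) s] by simp
qed

lemma free_const_commute: "free_const c * a = a * (free_const c :: 'k::field free_algebra)"
  by (induction a rule: free_algebra_induct)
     (simp_all add: mult_single mult.commute distrib_left distrib_right)

lemma jscale_mult_left: "jscale c a * b = jscale c (a * b)"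
  by transfer (simp add: equivp_reflp[OF equivp_jordan_rel] mult.assoc)

lemma jscale_mult_right: "a * jscale c b = jscale c (a * b)"
proof transfer
  fix a b :: "'a free_algebra" and c
  have "a * (free_const c * b) = free_const c * (a * b)"
    by (metis free_const_commute mult.assoc)
  then show "jordan_rel (a * (free_const c * b)) (free_const c * (a * b))"
    by (simp add: equivp_reflp[OF equivp_jordan_rel])
qed

context
begin

interpretation vs: vector_space "jscale :: 'k::field \<Rightarrow> _"
  by (rule vector_space_jscale)

lemmas jscale_simps = jscale_mult_left jscale_mult_right vs.scale_scale vs.scale_right_distrib
  vs.scale_left_distrib vs.scale_zero_left vs.scale_zero_right vs.scale_one vs.scale_minus_right
  vs.scale_right_diff_distrib vs.scale_sum_right

end

lemma jalgebra_homD: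
  assumes "jalgebra_hom \<rho>"
  shows "\<rho> (a + b) = \<rho> a + \<rho> b" "\<rho> (jscale c a) = jscale c (\<rho> a)"
    "\<rho> 1 = 1" "\<rho> (a * b) = \<rho> a * \<rho> b" "\<rho> 0 = 0" "\<rho> (- a) = - \<rho> a"
    "\<rho> (a - b) = \<rho> a - \<rho> b" "\<rho> (a ^ n) = \<rho> a ^ n"
proof -
  interpret Vector_Spaces.linear jscale jscale \<rho>
    using assms by (simp add: jalgebra_hom_def)
  show "\<rho> (a + b) = \<rho> a + \<rho> b" "\<rho> (jscale c a) = jscale c (\<rho> a)"
    "\<rho> 0 = 0" "\<rho> (- a) = - \<rho> a" "\<rho> (a - b) = \<rho> a - \<rho> b"
    by (simp_all add: add scale zero neg diff)
  show one: "\<rho> 1 = 1" and mult: "\<rho> (a * b) = \<rho> a * \<rho> b" for a b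
    using assms by (simp_all add: jalgebra_hom_def)
  show "\<rho> (a ^ n) = \<rho> a ^ n"
    by (induction n) (simp_all add: one mult)
qed

lemma jalgebra_homI:
  assumes "\<And>a b. \<rho> (a + b) = \<rho> a + \<rho> b" "\<And>c a. \<rho> (jscale c a) = jscale c (\<rho> a)"
    "\<rho> 1 = 1" "\<And>a b. \<rho> (a * b) = \<rho> a * \<rho> b"
  shows "jalgebra_hom \<rho>"
  unfolding jalgebra_hom_def using assms
  by (auto simp: Vector_Spaces.linear_def module_hom_def module_hom_axioms_def vector_space_jscale
      module_iff_vector_space)

lemma jalgebra_hom_compose: "jalgebra_hom \<rho> \<Longrightarrow> jalgebra_hom \<sigma> \<Longrightarrow> jalgebra_hom (\<rho> \<circ> \<sigma>)"
  by (rule jalgebra_homI) (simp_all add: jalgebra_homD)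

lemma jalgebra_hom_id: "jalgebra_hom id"
  by (rule jalgebra_homI) simp_all

lemma jalgebra_hom_jeval: "jalgebra_hom \<rho> \<Longrightarrow> \<rho> (jeval p b) = jeval p (\<rho> b)"
proof -
  assume h: "jalgebra_hom \<rho>"
  have "\<rho> (sum f A) = (\<Sum>i\<in>A. \<rho> (f i))" for f :: "nat \<Rightarrow> _" and A
    by (induction A rule: infinite_finite_induct) (simp_all add: jalgebra_homD[OF h])
  then show ?thesis
    by (simp add: jeval_def jalgebra_homD[OF h])
qed

lemma jalgebra_hom_eqI:
  assumes h: "jalgebra_hom \<rho>" "jalgebra_hom \<sigma>" and "\<rho> jX = \<sigma> jX" "\<rho> jY = \<sigma> jY"
  shows "\<rho> = \<sigma>"
proof
  fix q :: "'a jordanian_plane"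
  obtain f where q: "q = abs_jordanian_plane f"
    by (metis Quotient_abs_rep Quotient_jordanian_plane)
  have gen: "\<rho> (abs_jordanian_plane (free_gen s)) = \<sigma> (abs_jordanian_plane (free_gen s))" for s
    using assms by (cases s) (simp_all add: jX_def jY_def)
  have word: "\<rho> (abs_jordanian_plane (Poly_Mapping.single (Word l) 1))
      = \<sigma> (abs_jordanian_plane (Poly_Mapping.single (Word l) 1))" for l
  proof (induction l)
    case Nil
    have "abs_jordanian_plane (Poly_Mapping.single (Word []) (1::'a)) = 1"
      by (simp add: one_jordanian_plane_def flip: zero_word_def)
    then show ?case by (simp add: jalgebra_homD[OF h(1)] jalgebra_homD[OF h(2)])
  next
    case (Cons s l)
    have "abs_jordanian_plane (Poly_Mapping.single (Word (s # l)) (1::'a))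
      = abs_jordanian_plane (free_gen s) * abs_jordanian_plane (Poly_Mapping.single (Word l) 1)"
      by (simp add: times_jordanian_plane.abs_eq free_gen_def mult_single)
    then show ?case
      by (simp add: Cons gen jalgebra_homD[OF h(1)] jalgebra_homD[OF h(2)])
  qed
  have "\<rho> (abs_jordanian_plane f) = \<sigma> (abs_jordanian_plane f)"
  proof (induction f rule: free_algebra_induct)
    case (single w c)
    obtain l where w: "w = Word l" by (cases w)
    have "abs_jordanian_plane (Poly_Mapping.single w c)
        = jscale c (abs_jordanian_plane (Poly_Mapping.single w 1))"
      by (simp add: jscale.abs_eq mult_single)
    then show ?case
      by (simp add: w word jalgebra_homD[OF h(1)] jalgebra_homD[OF h(2)])
  next
    case (add f g)
    then show ?case
      by (simp add: jalgebra_homD[OF h(1)] jalgebra_homD[OF h(2)] flip: plus_jordanian_plane.abs_eq)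
  qed
  then show "\<rho> q = \<sigma> q" by (simp add: q)
qed

context
  fixes a b :: "'k::field jordanian_plane"
begin

private definition evw :: "word \<Rightarrow> 'k jordanian_plane" where
  "evw w = (case w of Word l \<Rightarrow> prod_list (map (\<lambda>s. case s of GX \<Rightarrow> a | GY \<Rightarrow> b) l))"

private definition ev :: "'k free_algebra \<Rightarrow> 'k jordanian_plane" where
  "ev f = (\<Sum>w\<in>Poly_Mapping.keys f. jscale (Poly_Mapping.lookup f w) (evw w))"

private lemma evw_add: "evw (u + v) = evw u * evw v"
  by (cases u; cases v) (simp add: evw_def)

private lemma ev_superset:
  assumes "finite S" "Poly_Mapping.keys f \<subseteq> S"
  shows "ev f = (\<Sum>w\<in>S. jscale (Poly_Mapping.lookup f w) (evw w))"
  unfolding ev_def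
  by (rule sum.mono_neutral_left) (use assms in \<open>auto simp: in_keys_iff jscale_simps\<close>)

private lemma ev_add: "ev (f + g) = ev f + ev g"
proof -
  let ?S = "Poly_Mapping.keys f \<union> Poly_Mapping.keys g"
  have "ev (f + g) = (\<Sum>w\<in>?S. jscale (Poly_Mapping.lookup (f + g) w) (evw w))"
    "ev f = (\<Sum>w\<in>?S. jscale (Poly_Mapping.lookup f w) (evw w))"
    "ev g = (\<Sum>w\<in>?S. jscale (Poly_Mapping.lookup g w) (evw w))"
    using Poly_Mapping.keys_add[of f g] by (auto intro!: ev_superset)
  then show ?thesis
    by (simp add: lookup_add jscale_simps sum.distrib)
qed

private lemma ev_single: "ev (Poly_Mapping.single w c) = jscale c (evw w)"
  by (simp add: ev_def jscale_simps)

private lemma ev_mult: "ev (f * g) = ev f * ev g"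
proof (induction f rule: free_algebra_induct)
  case (single w c)
  show ?case
    by (induction g rule: free_algebra_induct)
       (simp_all add: mult_single ev_single evw_add jscale_simps distrib_left ev_add mult.commute)
qed (simp add: distrib_right ev_add)

private lemma ev_0: "ev 0 = 0"
  by (simp add: ev_def)

private lemma ev_diff: "ev (f - g) = ev f - ev g"
  using ev_add[of "f - g" g] by simp

private lemma ev_1: "ev 1 = 1"
proof -
  have "evw 0 = 1" by (simp add: evw_def zero_word_def)
  then show ?thesis using ev_single[of 0 1] by (simp add: jscale_simps)
qed

private lemma ev_gen: "ev (free_gen GX) = a" "ev (free_gen GY) = b"
  by (simp_all add: free_gen_def ev_single evw_def jscale_simps)

lemma jalgebra_hom_exists:
  assumes rel: "b * a = a * b + b ^ 2"
  shows "\<exists>\<rho>. jalgebra_hom \<rho> \<and> \<rho> jX = a \<and> \<rho> jY = b"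
proof -
  have "ev f = 0" if "f \<in> jordan_ideal" for f
    using that
    by (induction rule: jordan_ideal.induct)
       (simp_all add: ev_0 ev_add ev_diff ev_mult ev_gen power2_eq_square rel)
  then have cong: "ev f = ev g" if "jordan_rel f g" for f g
    using that ev_diff[of f g] by (simp add: jordan_rel_def)
  define \<rho> where "\<rho> q = ev (rep_jordanian_plane q)" for q
  have abs: "\<rho> (abs_jordanian_plane f) = ev f" for f
    unfolding \<rho>_def
    by (rule cong) (metis Quotient_jordanian_plane Quotient_rep_abs equivp_jordan_rel equivp_reflp)
  have ex: "\<exists>f. q = abs_jordanian_plane f" for q :: "'k jordanian_plane"
    by (metis Quotient_abs_rep Quotient_jordanian_plane)
  have "jalgebra_hom \<rho>"
  proof (rule jalgebra_homI)
    fix p q :: "'k jordanian_plane" and c :: 'k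
    obtain f g where pq: "p = abs_jordanian_plane f" "q = abs_jordanian_plane g"
      using ex by blast
    show "\<rho> (p + q) = \<rho> p + \<rho> q"
      by (simp add: pq plus_jordanian_plane.abs_eq abs ev_add)
    show "\<rho> (p * q) = \<rho> p * \<rho> q"
      by (simp add: pq times_jordanian_plane.abs_eq abs ev_mult)
    show "\<rho> (jscale c p) = jscale c (\<rho> p)"
      by (simp add: pq jscale.abs_eq abs ev_mult ev_single)
         (simp add: evw_def zero_word_def jscale_simps)
    show "\<rho> 1 = 1"
      by (simp add: one_jordanian_plane_def abs ev_1)
  qed
  moreover have "\<rho> jX = a" "\<rho> jY = b"
    by (simp_all add: jX_def jY_def abs ev_gen)
  ultimately show ?thesis by blast
qed

end

lemma jeval_commute: "b * c = c * b \<Longrightarrow> jeval p b * c = c * jeval p b"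
  by (simp add: jeval_def sum_distrib_left sum_distrib_right jscale_simps power_commuting_commutes)

lemma jscale_rel:
  fixes h :: "'k::field jordanian_plane"
  assumes "jY * h = h * jY"
  shows "jscale c jY * (jscale c jX + h) = (jscale c jX + h) * jscale c jY + (jscale c jY)\<^sup>2"
  using assms
  by (simp add: power2_eq_square jscale_simps distrib_left distrib_right jY_jX[unfolded power2_eq_square])

lemma jphi_unique:
  fixes g :: "'k::field poly"
  assumes "\<gamma> \<noteq> 0"
  shows "\<exists>!\<rho>. \<rho> \<in> jaut \<and> \<rho> jX = jscale \<gamma> jX + jeval g jY \<and> \<rho> jY = jscale \<gamma> jY"
proof -
  define \<gamma>' where "\<gamma>' = inverse \<gamma>"
  have inv: "\<gamma> * \<gamma>' = 1" "\<gamma>' * \<gamma> = 1"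
    using assms by (simp_all add: \<gamma>'_def)
  define h where "h = jeval g (jscale \<gamma>' jY)"
  have com: "jY * jeval g jY = jeval g jY * jY" "jY * h = h * jY"
    unfolding h_def by (rule jeval_commute[symmetric], simp add: jscale_simps)+
  have com': "jY * (- jscale \<gamma>' h) = (- jscale \<gamma>' h) * jY"
    using com(2) by (simp add: jscale_simps)
  obtain \<rho> where \<rho>: "jalgebra_hom \<rho>" "\<rho> jX = jscale \<gamma> jX + jeval g jY" "\<rho> jY = jscale \<gamma> jY"
    using jalgebra_hom_exists[OF jscale_rel[OF com(1), of \<gamma>]] by blast
  obtain \<sigma> where \<sigma>: "jalgebra_hom \<sigma>" "\<sigma> jX = jscale \<gamma>' jX + (- jscale \<gamma>' h)" "\<sigma> jY = jscale \<gamma>' jY"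
    using jalgebra_hom_exists[OF jscale_rel[OF com', of \<gamma>']] by blast
  have "\<rho> \<circ> \<sigma> = id"
    by (rule jalgebra_hom_eqI)
       (simp_all add: jalgebra_hom_compose jalgebra_hom_id \<rho> \<sigma> h_def jalgebra_homD[OF \<rho>(1)]
          jalgebra_hom_jeval[OF \<rho>(1)] jscale_simps inv)
  moreover have "\<sigma> \<circ> \<rho> = id"
    by (rule jalgebra_hom_eqI)
       (simp_all add: jalgebra_hom_compose jalgebra_hom_id \<rho> \<sigma> h_def jalgebra_homD[OF \<sigma>(1)]
          jalgebra_hom_jeval[OF \<sigma>(1)] jscale_simps inv)
  ultimately have "\<rho> \<in> jaut"
    using o_bij[of \<sigma> \<rho>] \<rho>(1) by (simp add: jaut_def)
  with \<rho> show ?thesis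
    by (auto simp: jaut_def intro!: jalgebra_hom_eqI)
qed

end

(* The Jordanian plane acts from the right on k[y][z], with y acting as multiplication by y and x as
   h |-> z h + y^2 dh/dy; acting on 1 sends x^i p(y) to z^i p(y) and so yields the coordinates of an
   element in the basis x^i y^j. Comparing the two highest coefficients in x of a product shows that k[y] is the
   centralizer of y, so the centre is k. All commutators lie in y^2 A and y^2 is itself one, hence
   an automorphism rho preserves y^2 A up to divisibility both ways; this forces rho(y) = gamma y, and
   then rho(x) - gamma x commutes with y. Finally rho commutes with ad w iff rho(w) - w is central,
   i.e. rho(w) = w + c, which is decided by the two highest coefficients in x. *)

theory Submission
  imports Defs
begin

section \<open>Normal forms\<close>

definition jder :: "'k::field poly poly \<Rightarrow> 'k poly poly" where
  "jder = map_poly (\<lambda>p. [:0, 0, 1:] * pderiv p)"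

lemma coeff_jder: "coeff (jder h) i = [:0, 0, 1:] * pderiv (coeff h i)"
  by (simp add: jder_def coeff_map_poly)

lemma jder_add: "jder (f + g) = jder f + jder g"
  by (rule poly_eqI) (simp only: coeff_jder coeff_add pderiv_add distrib_left)

lemma smult_const_add: "smult [:a + b:] f = smult [:a:] f + smult [:b:] f"
  by (simp flip: smult_add_left)

lemma jder_smult_const: "jder (smult [:c:] f) = smult [:c:] (jder f)"
  by (rule poly_eqI) (simp add: coeff_jder pderiv_smult)

lemma jder_pCons: "jder (pCons p f) = pCons ([:0, 0, 1:] * pderiv p) (jder f)"
  by (rule poly_eqI) (simp add: coeff_jder coeff_pCons split: nat.split)

lemma jder_0: "jder 0 = 0"
  by (rule poly_eqI) (simp add: coeff_jder)

text \<open>Right multiplication by x and by y on normal forms in which z stands for x and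
  polynomials in y are written to the right of powers of x. For x it encodes p(y) x = x p(y) + y^2
  p'(y).\<close>

fun jstep :: "gen \<Rightarrow> 'k::field poly poly \<Rightarrow> 'k poly poly" where
  "jstep GX h = pCons 0 h + jder h"
| "jstep GY h = smult [:0, 1:] h"

lemma jstep_add: "jstep s (f + g) = jstep s f + jstep s g"
  by (cases s) (simp_all add: jder_add smult_add_right)

lemma jstep_smult_const: "jstep s (smult [:c:] f) = smult [:c:] (jstep s f)"
  by (cases s) (simp_all add: jder_smult_const smult_add_right)

text \<open>Leibniz rule: y^2 d/dy (y h) = y (y^2 dh/dy) + y^2 h. The operators compose in the order
  opposite to \<open>jY_jX\<close> because the action is from the right.\<close>

lemma jstep_rel: "jstep GX (jstep GY h) = jstep GY (jstep GX h) + jstep GY (jstep GY h)"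
  by (rule poly_eqI)
     (simp add: coeff_jder coeff_pCons pderiv_pCons pderiv_mult algebra_simps split: nat.split)

text \<open>\<open>fold\<close> lets the leftmost letter act first, which makes concatenation a
  right action.\<close>

definition word_act :: "word \<Rightarrow> 'k::field poly poly \<Rightarrow> 'k poly poly" where
  "word_act w = (case w of Word l \<Rightarrow> fold jstep l)"

lemma word_act_plus: "word_act (u + v) h = word_act v (word_act u h)"
  by (cases u; cases v) (simp add: word_act_def)

lemma word_act_add: "word_act w (f + g) = word_act w f + word_act w g"
proof -
  have "fold jstep l (f + g) = fold jstep l f + fold jstep l g" for l
    by (induction l arbitrary: f g) (simp_all add: jstep_add)
  then show ?thesis by (cases w) (simp add: word_act_def)
qed

lemma word_act_smult_const: "word_act w (smult [:c:] f) = smult [:c:] (word_act w f)"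
proof -
  have "fold jstep l (smult [:c:] f) = smult [:c:] (fold jstep l f)" for l
    by (induction l arbitrary: f) (simp_all add: jstep_smult_const)
  then show ?thesis by (cases w) (simp add: word_act_def)
qed

definition free_act :: "'k::field free_algebra \<Rightarrow> 'k poly poly \<Rightarrow> 'k poly poly" where
  "free_act a h = (\<Sum>w\<in>Poly_Mapping.keys a. smult [:Poly_Mapping.lookup a w:] (word_act w h))"

lemma free_act_superset:
  assumes "finite S" "Poly_Mapping.keys a \<subseteq> S"
  shows "free_act a h = (\<Sum>w\<in>S. smult [:Poly_Mapping.lookup a w:] (word_act w h))"
  unfolding free_act_def
  by (rule sum.mono_neutral_left) (use assms in \<open>auto simp: in_keys_iff\<close>)

lemma free_act_plus: "free_act (a + b) h = free_act a h + free_act b h"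
proof -
  let ?S = "Poly_Mapping.keys a \<union> Poly_Mapping.keys b"
  have "free_act (a + b) h = (\<Sum>w\<in>?S. smult [:Poly_Mapping.lookup (a + b) w:] (word_act w h))"
    "free_act a h = (\<Sum>w\<in>?S. smult [:Poly_Mapping.lookup a w:] (word_act w h))"
    "free_act b h = (\<Sum>w\<in>?S. smult [:Poly_Mapping.lookup b w:] (word_act w h))"
    using Poly_Mapping.keys_add[of a b] by (auto intro!: free_act_superset)
  then show ?thesis
    by (simp add: lookup_add sum.distrib smult_const_add)
qed

lemma free_act_single: "free_act (Poly_Mapping.single w c) h = smult [:c:] (word_act w h)"
  by (simp add: free_act_def)

lemma free_act_add: "free_act a (f + g) = free_act a f + free_act a g"
  by (simp add: free_act_def word_act_add smult_add_right sum.distrib)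

lemma free_act_smult_const: "free_act a (smult [:c:] f) = smult [:c:] (free_act a f)"
  by (induction a rule: free_algebra_induct)
     (simp_all add: free_act_single free_act_plus word_act_smult_const smult_add_right mult.commute)

lemma free_act_zero: "free_act a 0 = 0"
  using free_act_add[of a 0 0] by (metis add_cancel_right_right)

lemma free_act_mult: "free_act (a * b) h = free_act b (free_act a h)"
proof (induction a rule: free_algebra_induct)
  case (single w c)
  show ?case
    by (induction b rule: free_algebra_induct)
       (simp_all add: mult_single free_act_single word_act_plus word_act_smult_const
          free_act_smult_const distrib_left free_act_plus smult_add_right mult.commute)
qed (simp add: distrib_right free_act_plus free_act_add)

lemma free_act_diff: "free_act (a - b) h = free_act a h - free_act b h"
  using free_act_plus[of "a - b" b h] by simp

lemma free_act_gen: "free_act (free_gen s) h = jstep s h"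
  by (simp add: free_gen_def free_act_single word_act_def flip: one_pCons)

text \<open>The vector \<open>h\<close> is generalized because in a left multiple
  \<open>r * a\<close> the element \<open>a\<close> acts on the image of \<open>h\<close> under
  \<open>r\<close>.\<close>

lemma free_act_jordan_ideal: "a \<in> jordan_ideal \<Longrightarrow> free_act a h = 0"
proof (induction arbitrary: h rule: jordan_ideal.induct)
  case rel
  show ?case
    by (simp only: free_act_diff free_act_plus free_act_mult free_act_gen power2_eq_square jstep_rel)
       simp
next
  case zero
  show ?case by (simp add: free_act_def)
qed (simp_all add: free_act_plus free_act_mult free_act_zero)

lift_definition jact :: "'k::field jordanian_plane \<Rightarrow> 'k poly poly \<Rightarrow> 'k poly poly" is free_act
proof (rule ext)
  fix a b :: "'k free_algebra" and h
  assume "jordan_rel a b"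
  then show "free_act a h = free_act b h"
    using free_act_jordan_ideal[of "a - b" h] by (simp add: jordan_rel_def free_act_diff)
qed

lemma jact_plus: "jact (a + b) h = jact a h + jact b h"
  by transfer (rule free_act_plus)

lemma jact_mult: "jact (a * b) h = jact b (jact a h)"
  by transfer (rule free_act_mult)

lemma jact_one: "jact 1 h = h"
  by transfer (simp add: free_act_single word_act_def zero_word_def flip: single_one one_pCons)

lemma jact_jX: "jact jX h = pCons 0 h + jder h"
  by transfer (simp add: free_act_gen)

lemma jact_jY: "jact jY h = smult [:0, 1:] h"
  by transfer (simp add: free_act_gen)

lemma jact_jscale: "jact (jscale c a) h = smult [:c:] (jact a h)"
  by transfer
     (simp add: free_act_mult free_act_single word_act_def zero_word_def free_act_smult_const)

lemma jact_zero: "jact 0 h = 0"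
  using jact_plus[of 0 0 h] by (metis add_cancel_right_right)

section \<open>Normal forms as elements of the plane\<close>

lemma jordanian_plane_induct [case_names one jX jY plus jscale mult]:
  fixes a :: "'k::field jordanian_plane"
  assumes one: "P 1" and X: "P jX" and Y: "P jY"
    and plus: "\<And>a b. P a \<Longrightarrow> P b \<Longrightarrow> P (a + b)"
    and scale: "\<And>c a. P a \<Longrightarrow> P (jscale c a)"
    and mult: "\<And>a b. P a \<Longrightarrow> P b \<Longrightarrow> P (a * b)"
  shows "P a"
proof -
  obtain f where a: "a = abs_jordanian_plane f"
    by (metis Quotient_abs_rep Quotient_jordanian_plane)
  have word: "P (abs_jordanian_plane (Poly_Mapping.single (Word l) 1))" for l
  proof (induction l)
    case Nil
    then show ?case
      using one by (simp add: one_jordanian_plane_def flip: zero_word_def)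
  next
    case (Cons s l)
    have gen: "P (abs_jordanian_plane (free_gen s))"
      using X Y by (cases s) (simp_all add: jX_def jY_def)
    have "abs_jordanian_plane (Poly_Mapping.single (Word (s # l)) (1::'k))
      = abs_jordanian_plane (free_gen s) * abs_jordanian_plane (Poly_Mapping.single (Word l) 1)"
      by (simp add: times_jordanian_plane.abs_eq free_gen_def mult_single)
    then show ?case by (simp add: mult[OF gen Cons])
  qed
  have "P (abs_jordanian_plane f)"
  proof (induction f rule: free_algebra_induct)
    case (single w c)
    obtain l where w: "w = Word l" by (cases w)
    have "abs_jordanian_plane (Poly_Mapping.single w c)
        = jscale c (abs_jordanian_plane (Poly_Mapping.single w 1))"
      by (simp add: jscale.abs_eq mult_single)
    then show ?case by (simp add: w scale[OF word])
  qed (simp add: plus flip: plus_jordanian_plane.abs_eq)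
  then show ?thesis by (simp add: a)
qed

lemma jeval_0: "jeval 0 b = 0"
  by (simp add: jeval_def jscale_simps)

lemma jeval_pCons: "jeval (pCons c p) b = jscale c 1 + b * jeval p b"
proof (cases "p = 0")
  case True
  then show ?thesis by (simp add: jeval_def jscale_simps)
next
  case False
  have "jeval (pCons c p) b = (\<Sum>i\<le>Suc (degree p). jscale (coeff (pCons c p) i) (b ^ i))"
    by (simp add: jeval_def False)
  also have "\<dots> = jscale c 1 + b * jeval p b"
    by (subst sum.atMost_Suc_shift) (simp add: jeval_def sum_distrib_left jscale_simps)
  finally show ?thesis .
qed

lemma jeval_add: "jeval (p + q) b = jeval p b + jeval q b"
  by (induction p q rule: poly_induct2)
     (simp_all add: jeval_0 jeval_pCons jscale_simps distrib_left algebra_simps)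

lemma jeval_smult: "jeval (smult c p) b = jscale c (jeval p b)"
  by (induction p) (simp_all add: jeval_0 jeval_pCons jscale_simps)

lemma jeval_mult: "jeval (p * q) b = jeval p b * jeval q b"
  by (induction p)
     (simp_all add: jeval_0 jeval_add jeval_smult jeval_pCons jscale_simps distrib_right mult.assoc)

text \<open>In the inductive step (y p) x = y x p + y^3 p', and y x = x y + y^2 supplies the extra
  y^2 p that completes y^2 (y p)'.\<close>

lemma jeval_jY_mult_jX:
  "jeval p jY * jX = jX * jeval p jY + jeval ([:0, 0, 1:] * pderiv p) jY"
proof (induction p)
  case 0
  then show ?case by (simp add: jeval_0)
next
  case (pCons c p)
  have "jeval (pCons c p) jY * jX
      = jscale c jX + jY * jX * jeval p jY + jY * jeval ([:0, 0, 1:] * pderiv p) jY"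
    by (simp add: jeval_pCons distrib_right distrib_left jscale_simps mult.assoc pCons)
  also have "\<dots> = jX * jeval (pCons c p) jY + (jY * (jY * jeval p jY)
      + jY * jeval ([:0, 0, 1:] * pderiv p) jY)"
    by (simp add: jeval_pCons jY_jX power2_eq_square distrib_right distrib_left jscale_simps mult.assoc)
  also have "jY * (jY * jeval p jY) + jY * jeval ([:0, 0, 1:] * pderiv p) jY
      = jeval ([:0, 0, 1:] * pderiv (pCons c p)) jY"
    by (simp add: jeval_pCons pderiv_pCons jeval_add jscale_simps distrib_left algebra_simps)
  finally show ?case .
qed

text \<open>Horner scheme for the sum of the x^i p_i(y), where p_i is the coefficient of
  z^i.\<close>

definition jnf :: "'k::field poly poly \<Rightarrow> 'k jordanian_plane" where
  "jnf f = fold_coeffs (\<lambda>p a. jeval p jY + jX * a) f 0"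

lemma jnf_0: "jnf 0 = 0"
  by (simp add: jnf_def)

lemma jnf_pCons: "jnf (pCons p f) = jeval p jY + jX * jnf f"
  by (cases "p = 0 \<and> f = 0") (auto simp: jnf_def jeval_0)

lemma jnf_add: "jnf (f + g) = jnf f + jnf g"
  by (induction f g rule: poly_induct2)
     (simp_all add: jnf_0 jnf_pCons jeval_add distrib_left algebra_simps)

lemma jnf_smult: "jnf (smult p f) = jnf f * jeval p jY"
  by (induction f)
     (simp_all add: jnf_0 jnf_pCons distrib_right mult.assoc mult.commute[of p] jeval_mult)

text \<open>By \<open>jeval_jY_mult_jX\<close> each summand x^i p(y) becomes x^(i+1) p(y) + x^i y^2
  p'(y).\<close>

lemma jnf_mult_jX: "jnf (pCons 0 f + jder f) = jnf f * jX"
proof (induction f)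
  case 0
  then show ?case by (simp add: jnf_0 jder_0)
next
  case (pCons p f)
  have "jnf (pCons 0 (pCons p f) + jder (pCons p f))
      = jX * jeval p jY + jeval ([:0, 0, 1:] * pderiv p) jY + jX * jnf (pCons 0 f + jder f)"
    by (simp add: jder_pCons jnf_pCons jnf_add jeval_0 distrib_left mult.assoc del: mult_pCons_left)
  also have "\<dots> = jnf (pCons p f) * jX"
    by (simp only: pCons.IH jnf_pCons distrib_right jeval_jY_mult_jX mult.assoc)
  finally show ?case .
qed

lemma jnf_jact: "jnf (jact a f) = jnf f * a"
proof (induction a arbitrary: f rule: jordanian_plane_induct)
  case jX
  then show ?case by (simp add: jact_jX jnf_mult_jX)
qed (simp_all add: jact_one jact_jY jact_plus jact_jscale jact_mult jnf_add jnf_smult distrib_left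
      jeval_pCons jeval_0 jscale_simps mult.assoc)

lemma jact_jeval: "jact (jeval p jY) h = smult p h"
  by (induction p arbitrary: h)
     (simp_all add: jeval_0 jeval_pCons jact_zero jact_plus jact_jscale jact_one jact_mult jact_jY
       flip: smult_add_left)

lemma jact_jnf_pCons: "jact (jnf (pCons p g)) f = smult p f + jact (jnf g) (pCons 0 f + jder f)"
  by (simp add: jnf_pCons jact_plus jact_mult jact_jeval jact_jX)

section \<open>Coordinates and the two highest coefficients of a product\<close>

definition jcoord :: "'k::field jordanian_plane \<Rightarrow> 'k poly poly" where
  "jcoord a = jact a 1"

text \<open>By \<open>jnf_jact\<close>, \<open>jnf\<close> is a map of right modules, and it sends 1
  to 1; so it is a left inverse of \<open>jcoord\<close>, and equal coordinates imply equal
  elements.\<close>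

lemma jnf_jcoord [simp]: "jnf (jcoord a) = a"
  by (simp add: jcoord_def jnf_jact one_pCons jnf_pCons jnf_0 jeval_pCons jeval_0 jscale_simps)

lemma jcoord_eq_iff: "jcoord a = jcoord b \<longleftrightarrow> a = b"
  by (metis jnf_jcoord)


lemma jcoord_mult: "jcoord (a * b) = jact b (jcoord a)"
  by (simp add: jcoord_def jact_mult)

lemma jcoord_add: "jcoord (a + b) = jcoord a + jcoord b"
  by (simp add: jcoord_def jact_plus)

lemma jcoord_zero: "jcoord 0 = 0"
  by (simp add: jcoord_def jact_zero)

lemma jcoord_one: "jcoord 1 = 1"
  by (simp add: jcoord_def jact_one)

lemma jcoord_jscale: "jcoord (jscale c a) = smult [:c:] (jcoord a)"
  by (simp add: jcoord_def jact_jscale)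

lemma jcoord_jeval: "jcoord (jeval p jY) = [:p:]"
  by (simp add: jcoord_def jact_jeval)

lemma jcoord_jX: "jcoord jX = [:0, 1:]"
  by (simp add: jcoord_def jact_jX one_pCons jder_pCons jder_0)

lemma jcoord_jY: "jcoord jY = [:[:0, 1:]:]"
  by (simp add: jcoord_def jact_jY)

lemma jcoord_eq_0_iff: "jcoord a = 0 \<longleftrightarrow> a = 0"
  by (metis jcoord_eq_iff jcoord_zero)

text \<open>Prepending a zero coefficient turns the coefficient at \<open>d - 1\<close> into the one at \<open>d\<close>, so that the
  subleading coefficient makes sense for \<open>d = 0\<close>.\<close>

lemma jact_jnf_leading:
  assumes "degree f \<le> d" "degree g \<le> e"
  shows "degree (jact (jnf g) f) \<le> d + e
    \<and> coeff (jact (jnf g) f) (d + e) = coeff f d * coeff g e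
    \<and> coeff (pCons 0 (jact (jnf g) f)) (d + e)
      = coeff f d * coeff (pCons 0 g) e + coeff (pCons 0 f) d * coeff g e
        + of_nat e * ([:0, 0, 1:] * pderiv (coeff f d)) * coeff g e"
  using assms
proof (induction g arbitrary: f d e)
  case 0
  then show ?case by (simp add: jnf_0 jact_zero)
next
  case (pCons p g)
  show ?case
  proof (cases e)
    case 0
    with pCons.prems have "g = 0" by (simp split: if_splits)
    then show ?thesis
      using pCons.prems 0 degree_smult_le[of p f]
      by (simp add: jact_jnf_pCons jnf_0 jact_zero coeff_pCons split: nat.split)
  next
    case (Suc e')
    \<comment> \<open>\<open>?f\<close> is \<open>f\<close> times x: peeling one power of x off the
      right factor raises \<open>d\<close> to \<open>Suc d\<close> and lowers \<open>e\<close> to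
      \<open>e'\<close>.\<close>
    let ?f = "pCons 0 f + jder f"
    have g: "degree g \<le> e'" using pCons.prems Suc by (simp split: if_splits)
    have high: "coeff f i = 0" if "i > d" for i
      using that pCons.prems(1) by (intro coeff_eq_0) simp
    have f: "degree ?f \<le> Suc d"
      by (rule degree_le) (auto simp: coeff_jder coeff_pCons high split: nat.split)
    \<comment> \<open>Each factor x adds y^2 times the derivative of the leading coefficient once;
      over the induction this yields the factor \<open>of_nat e\<close>.\<close>
    have lead: "coeff ?f (Suc d) = coeff f d"
      "coeff (pCons 0 ?f) (Suc d) = coeff (pCons 0 f) d + [:0, 0, 1:] * pderiv (coeff f d)"
      by (simp_all only: coeff_pCons_Suc coeff_add coeff_jder) (simp add: high)
    note IH = pCons.IH[OF f g, unfolded lead]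
    have "degree (smult p f) \<le> Suc d + e'"
      using degree_smult_le[of p f] pCons.prems(1) by linarith
    then have "degree (jact (jnf (pCons p g)) f) \<le> d + e"
      using IH Suc by (simp add: jact_jnf_pCons degree_add_le)
    moreover have "coeff (jact (jnf (pCons p g)) f) (d + e) = coeff f d * coeff (pCons p g) e"
      using IH Suc by (simp add: jact_jnf_pCons high)
    moreover have "coeff (pCons 0 (jact (jnf (pCons p g)) f)) (d + e)
      = p * coeff f (d + e') + coeff (pCons 0 (jact (jnf g) ?f)) (Suc d + e')"
      by (simp add: jact_jnf_pCons Suc)
    \<comment> \<open>The term with \<open>p\<close> survives only for \<open>e' = 0\<close>;
      otherwise \<open>d + e'\<close> exceeds the degree bound of \<open>f\<close>.\<close>
    moreover have "p * coeff f (d + e') + coeff f d * coeff (pCons 0 g) e'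
      = coeff f d * coeff (pCons p g) e'"
      by (cases e') (simp_all add: high)
    ultimately show ?thesis
      using IH Suc by (simp add: algebra_simps del: mult_pCons_left)
  qed
qed

text \<open>Writing b as \<open>jnf\<close> of its coordinates reduces this to
  \<open>jact_jnf_leading\<close>. The derivative term comes from p(y) x^e = x^e p(y) + e x^(e-1)
  y^2 p'(y) + lower powers of x.\<close>

lemma jcoord_mult_leading:
  assumes "degree (jcoord a) \<le> d" "degree (jcoord b) \<le> e"
  shows degree_jcoord_mult_le: "degree (jcoord (a * b)) \<le> d + e"
    and coeff_jcoord_mult: "coeff (jcoord (a * b)) (d + e) = coeff (jcoord a) d * coeff (jcoord b) e"
    and subcoeff_jcoord_mult: "coeff (pCons 0 (jcoord (a * b))) (d + e)
      = coeff (jcoord a) d * coeff (pCons 0 (jcoord b)) e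
        + coeff (pCons 0 (jcoord a)) d * coeff (jcoord b) e
        + of_nat e * ([:0, 0, 1:] * pderiv (coeff (jcoord a) d)) * coeff (jcoord b) e"
  using jact_jnf_leading[OF assms] by (simp_all add: jcoord_mult)

text \<open>Leading coefficients multiply in the domain k[y], so nothing cancels at the top.\<close>

lemma degree_jcoord_mult:
  assumes "a \<noteq> 0" "b \<noteq> 0"
  shows "degree (jcoord (a * b)) = degree (jcoord a) + degree (jcoord b)"
proof (rule antisym)
  show "degree (jcoord (a * b)) \<le> degree (jcoord a) + degree (jcoord b)"
    by (rule degree_jcoord_mult_le) simp_all
  have "jcoord a \<noteq> 0" "jcoord b \<noteq> 0"
    using assms by (simp_all add: jcoord_eq_0_iff)
  then show "degree (jcoord a) + degree (jcoord b) \<le> degree (jcoord (a * b))"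
    by (intro le_degree) (simp add: coeff_jcoord_mult)
qed

lemma jeval_eq_iff: "jeval p jY = jeval q jY \<longleftrightarrow> p = q"
  by (metis jcoord_jeval pCons_eq_iff)

lemma jeval_coeff_0: "degree (jcoord a) = 0 \<Longrightarrow> a = jeval (coeff (jcoord a) 0) jY"
  by (metis degree_0_id jcoord_eq_iff jcoord_jeval)

section \<open>Centralizers\<close>

text \<open>Let d be the degree of a in x and f_d its leading coefficient. One degree below the top,
  y a exceeds a y by d y^2 f_d; in characteristic zero this forces d = 0.\<close>

lemma commute_jY_imp_jeval:
  fixes a :: "'k::field_char_0 jordanian_plane"
  assumes "jY * a = a * jY"
  obtains p where "a = jeval p jY"
proof
  let ?f = "jcoord a" and ?d = "degree (jcoord a)"
  have "coeff (pCons 0 (jcoord (jY * a))) (0 + ?d)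
      = [:0, 1:] * coeff (pCons 0 ?f) ?d + of_nat ?d * [:0, 0, 1:] * coeff ?f ?d"
    by (subst subcoeff_jcoord_mult)
       (simp_all add: jcoord_jY pderiv_pCons del: mult_pCons_left of_nat_poly)
  moreover have "jcoord (a * jY) = smult [:0, 1:] ?f"
    by (simp add: jcoord_mult jact_jY)
  then have "coeff (pCons 0 (jcoord (a * jY))) ?d = [:0, 1:] * coeff (pCons 0 ?f) ?d"
    by (cases ?d) simp_all
  ultimately have "of_nat ?d * [:0, 0, 1:] * coeff ?f ?d = 0"
    using assms by simp
  then have "?d = 0"
    by (auto simp del: mult_pCons_left mult_pCons_right)
  then show "a = jeval (coeff ?f 0) jY" by (rule jeval_coeff_0)
qed

text \<open>Commuting with y leaves only some p(y); commuting with x then gives y^2 p' = 0, so p is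
  constant in characteristic zero.\<close>

lemma central_imp_scalar:
  fixes a :: "'k::field_char_0 jordanian_plane"
  assumes "\<And>b. a * b = b * a"
  obtains c where "a = jscale c 1"
proof -
  obtain p where p: "a = jeval p jY"
    using commute_jY_imp_jeval[of a] assms by metis
  have "jeval ([:0, 0, 1:] * pderiv p) jY = jeval 0 jY"
    using jeval_jY_mult_jX[of p] assms[of jX] by (simp add: p jeval_0 del: mult_pCons_left)
  then have "pderiv p = 0"
    by (simp add: jeval_eq_iff del: mult_pCons_left)
  then have "degree p = 0" by (simp add: pderiv_eq_0_iff)
  then obtain c where "p = [:c:]" by (rule degree_eq_zeroE)
  then have "a = jscale c 1" by (simp add: p jeval_pCons jeval_0)
  then show thesis by (rule that)
qed

section \<open>Automorphisms\<close>

text \<open>This makes the right ideal y^2 A two-sided, so that factors can be moved past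
  y^2.\<close>

lemma mult_jY_square: "\<exists>c. b * jY\<^sup>2 = jY\<^sup>2 * c"
proof (induction b rule: jordanian_plane_induct)
  case one
  show ?case by (metis mult.left_neutral mult.right_neutral)
next
  case jX
  \<comment> \<open>Moving x past y twice gives y^2 x = x y^2 + 2 y^3, whence the witness x - 2
    y.\<close>
  have "jX * jY\<^sup>2 = jY\<^sup>2 * (jX - (jY + jY) :: 'a jordanian_plane)"
  proof -
    have "jY * (jY * jX) = jY * (jX * jY) + jY * (jY * jY :: 'a jordanian_plane)"
      by (simp add: jY_jX power2_eq_square distrib_left)
    also have "jY * (jX * jY) = jX * (jY * jY) + jY * (jY * jY)"
      using arg_cong[OF jY_jX, of "\<lambda>a. a * jY"]
      by (simp add: power2_eq_square distrib_right mult.assoc)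
    finally show ?thesis
      by (simp add: power2_eq_square right_diff_distrib distrib_left mult.assoc add.assoc)
  qed
  then show ?case by blast
next
  case jY
  show ?case by (metis power_commutes)
next
  case (plus a b)
  then show ?case by (metis distrib_left distrib_right)
next
  case (jscale c a)
  then show ?case by (metis jscale_mult_left jscale_mult_right)
next
  case (mult a b)
  then show ?case by (metis mult.assoc)
qed

text \<open>The generators commute modulo the two-sided ideal y^2 A, so the quotient is commutative.
  The proof passes from generators to all elements, one argument of the commutator at a
  time.\<close>

lemma commutator_dvd_jY_square: "\<exists>c. a * b - b * a = jY\<^sup>2 * c"
proof -
  have closed: "\<exists>c. a * (b * b') - (b * b') * a = jY\<^sup>2 * c"
    if "\<exists>c. a * b - b * a = jY\<^sup>2 * c" "\<exists>c. a * b' - b' * a = jY\<^sup>2 * c"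
    for a b b' :: "'a jordanian_plane"
  proof -
    from that obtain c c' where c: "a * b - b * a = jY\<^sup>2 * c" "a * b' - b' * a = jY\<^sup>2 * c'"
      by blast
    obtain d where d: "b * jY\<^sup>2 = jY\<^sup>2 * d" using mult_jY_square by blast
    \<comment> \<open>Leibniz rule for commutators; \<open>d\<close> then moves \<open>b\<close>
      past y^2.\<close>
    have "a * (b * b') - (b * b') * a = (a * b - b * a) * b' + b * (a * b' - b' * a)"
      by (simp add: algebra_simps)
    also have "\<dots> = jY\<^sup>2 * (c * b' + d * c')"
      by (simp add: c distrib_left flip: mult.assoc) (simp add: d)
    finally show ?thesis by blast
  qed
  have swap: "\<exists>c. b * a - a * b = jY\<^sup>2 * c" if "\<exists>c. a * b - b * a = jY\<^sup>2 * c"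
    for a b :: "'a jordanian_plane"
    using that by (metis minus_diff_eq mult_minus_right)
  have extend: "\<exists>c. a * b - b * a = jY\<^sup>2 * c"
    if "\<exists>c. a * jX - jX * a = jY\<^sup>2 * c" "\<exists>c. a * jY - jY * a = jY\<^sup>2 * c"
    for a b :: "'a jordanian_plane"
  proof (induction b rule: jordanian_plane_induct)
    case one
    show ?case by (rule exI[of _ 0]) simp
  next
    case (plus b b')
    then show ?case by (metis (no_types) add_diff_add distrib_left distrib_right)
  next
    case (jscale c b)
    then obtain d where "a * b - b * a = jY\<^sup>2 * d" by blast
    then have "a * jscale c b - jscale c b * a = jY\<^sup>2 * jscale c d"
      by (simp add: jscale_simps flip: jscale_simps(10))
    then show ?case by blast
  qed (use that closed in blast)+
  have "jX * jY - jY * jX = jY\<^sup>2 * (- 1 :: 'a jordanian_plane)"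
    by (simp add: jY_jX)
  then have XY: "\<exists>c. jX * jY - jY * jX = jY\<^sup>2 * (c :: 'a jordanian_plane)" by blast
  have triv: "\<exists>c. a * a - a * a = jY\<^sup>2 * c" for a :: "'a jordanian_plane"
    by (rule exI[of _ 0]) simp
  \<comment> \<open>\<open>extend\<close> is used with x and with y as its first argument; swapped,
    it shows that any \<open>a\<close> commutes with both generators modulo y^2 A.\<close>
  have "\<exists>c. a * jX - jX * a = jY\<^sup>2 * c" "\<exists>c. a * jY - jY * a = jY\<^sup>2 * c"
    using swap[OF extend[OF triv XY]] swap[OF extend[OF swap[OF XY] triv]] by blast+
  then show ?thesis by (rule extend)
qed

text \<open>From y^2 | q^2 follows q(0) = 0, so q = y r; cancelling y^2 in the other divisibility
  shows that r is a unit, hence a nonzero constant.\<close>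

lemma poly_squares_associated_y:
  fixes q :: "'k::field poly"
  assumes "q\<^sup>2 dvd [:0, 1:]\<^sup>2" "[:0, 1:]\<^sup>2 dvd q\<^sup>2"
  obtains c where "c \<noteq> 0" "q = [:0, c:]"
proof -
  obtain k where "q\<^sup>2 = [:0, 1:]\<^sup>2 * k" using assms(2) by (rule dvdE)
  then have "poly (q\<^sup>2) 0 = poly ([:0, 1:]\<^sup>2 * k) 0" by (rule arg_cong)
  then have "[:0, 1:] dvd q"
    using poly_eq_0_iff_dvd[of q 0] by simp
  then obtain r where r: "q = [:0, 1:] * r" by (rule dvdE)
  obtain s where "[:0, 1:]\<^sup>2 = q\<^sup>2 * s" using assms(1) by (rule dvdE)
  then have "[:0, 1:]\<^sup>2 * (r\<^sup>2 * s) = [:0, 1:]\<^sup>2 * 1"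
    by (simp only: r power_mult_distrib mult.assoc mult_1_right)
  then have "r\<^sup>2 * s = 1"
    by (metis mult_cancel_left pCons_eq_0_iff power_not_zero zero_neq_one)
  then have "r dvd 1" by (metis dvdI mult.assoc power2_eq_square)
  then obtain c where "r = [:c:]" "c \<noteq> 0"
    using is_unit_poly_iff[of r] by fastforce
  then show thesis by (intro that[of c]) (simp_all add: r)
qed

section \<open>Determination of all automorphisms\<close>

lemma jaut_cases:
  fixes \<rho> :: "'k::field_char_0 jordanian_plane \<Rightarrow> 'k jordanian_plane"
  assumes "\<rho> \<in> jaut"
  obtains \<gamma> g where "\<gamma> \<noteq> 0" "\<rho> = jphi \<gamma> g"
proof -
  have hom: "jalgebra_hom \<rho>" and "bij \<rho>"
    using assms by (auto simp: jaut_def)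
  note \<rho> = jalgebra_homD[OF hom]
  have rel: "\<rho> jY * \<rho> jX = \<rho> jX * \<rho> jY + (\<rho> jY)\<^sup>2"
    using arg_cong[OF jY_jX, of \<rho>] by (simp add: \<rho>)
  have "jY \<noteq> (0 :: 'k jordanian_plane)"
    by (simp add: jcoord_jY flip: jcoord_eq_0_iff)
  \<comment> \<open>The square of \<rho>(y) is the commutator of \<rho>(y) and \<rho>(x).\<close>
  obtain a where a: "(\<rho> jY)\<^sup>2 = jY\<^sup>2 * a"
    using commutator_dvd_jY_square[of "\<rho> jY" "\<rho> jX"] rel by auto
  obtain u v where uv: "\<rho> u = jX" "\<rho> v = jY"
    using \<open>bij \<rho>\<close> by (metis bij_pointE)
  \<comment> \<open>Conversely, y^2 is the commutator of y and x, which is the image of the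
    commutator of their preimages \<open>v\<close> and \<open>u\<close>.\<close>
  obtain b where "v * u - u * v = jY\<^sup>2 * b"
    using commutator_dvd_jY_square by blast
  from arg_cong[OF this, of \<rho>] have b: "jY\<^sup>2 = (\<rho> jY)\<^sup>2 * \<rho> b"
    by (simp add: \<rho> uv jY_jX)
  have sq: "jY\<^sup>2 = jeval ([:0, 1:]\<^sup>2) (jY :: 'k jordanian_plane)"
    by (simp add: power2_eq_square jeval_pCons jeval_0 jscale_simps)
  have "[:0, 1:]\<^sup>2 \<noteq> (0 :: 'k poly)" by simp
  then have "jY\<^sup>2 \<noteq> (0 :: 'k jordanian_plane)"
    by (simp add: sq jcoord_jeval flip: jcoord_eq_0_iff)
  with b have nz: "\<rho> jY \<noteq> 0" "(\<rho> jY)\<^sup>2 \<noteq> 0" "\<rho> b \<noteq> 0" "a \<noteq> 0"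
    using a by auto
  \<comment> \<open>Degrees in x are additive and y^2 has degree 0. So \<rho>(y) and both cofactors
    lie in k[y], where the two divisibilities can be used.\<close>
  have "degree (jcoord (jY\<^sup>2 :: 'k jordanian_plane)) = 0"
    by (simp add: sq jcoord_jeval)
  moreover have "degree (jcoord (jY\<^sup>2 :: 'k jordanian_plane)) = degree (jcoord (\<rho> jY)) + degree (jcoord (\<rho> jY))
      + degree (jcoord (\<rho> b))"
    using nz by (subst b) (simp add: degree_jcoord_mult power2_eq_square)
  moreover have "degree (jcoord ((\<rho> jY)\<^sup>2)) = degree (jcoord (jY\<^sup>2 :: 'k jordanian_plane)) + degree (jcoord a)"
    using nz \<open>jY\<^sup>2 \<noteq> 0\<close> by (subst a) (simp add: degree_jcoord_mult)
  moreover have "degree (jcoord ((\<rho> jY)\<^sup>2)) = degree (jcoord (\<rho> jY)) + degree (jcoord (\<rho> jY))"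
    using nz by (simp add: degree_jcoord_mult power2_eq_square)
  ultimately have "degree (jcoord (\<rho> jY)) = 0" "degree (jcoord (\<rho> b)) = 0" "degree (jcoord a) = 0"
    by simp_all
  then obtain q a' b' where q: "\<rho> jY = jeval q jY" "a = jeval a' jY" "\<rho> b = jeval b' jY"
    by (metis jeval_coeff_0)
  have sq': "(\<rho> jY)\<^sup>2 = jeval (q\<^sup>2) jY"
    by (simp add: q power2_eq_square jeval_mult)
  have "q\<^sup>2 dvd [:0, 1:]\<^sup>2"
    using b unfolding sq sq' q(3) jeval_mult[symmetric] jeval_eq_iff by (rule dvdI)
  moreover have "[:0, 1:]\<^sup>2 dvd q\<^sup>2"
    using a unfolding sq sq' q(2) jeval_mult[symmetric] jeval_eq_iff by (rule dvdI)
  ultimately obtain \<gamma> where \<gamma>: "\<gamma> \<noteq> 0" "q = [:0, \<gamma>:]"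
    by (rule poly_squares_associated_y)
  then have Y: "\<rho> jY = jscale \<gamma> jY"
    by (simp add: q jeval_pCons jeval_0 jscale_simps)
  have "jscale \<gamma> (jY * \<rho> jX) = jscale \<gamma> (\<rho> jX * jY + jscale \<gamma> (jY\<^sup>2))"
    using rel by (simp add: Y jscale_simps power2_eq_square)
  \<comment> \<open>Scaling by the inverse removes one factor \<gamma> from the relation between the
    images.\<close>
  then have "jscale (inverse \<gamma> * \<gamma>) (jY * \<rho> jX)
      = jscale (inverse \<gamma> * \<gamma>) (\<rho> jX * jY + jscale \<gamma> (jY\<^sup>2))"
    by (simp only: flip: jscale_simps(3))
  then have "jY * \<rho> jX = \<rho> jX * jY + jscale \<gamma> (jY\<^sup>2)"
    using \<gamma>(1) by (simp add: jscale_simps)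
  \<comment> \<open>\<gamma> x satisfies the same inhomogeneous relation as \<rho>(x), so the
    difference commutes with y.\<close>
  then have "jY * (\<rho> jX - jscale \<gamma> jX) = (\<rho> jX - jscale \<gamma> jX) * jY"
    by (simp add: right_diff_distrib left_diff_distrib jscale_simps jY_jX)
  then obtain g where "\<rho> jX - jscale \<gamma> jX = jeval g jY"
    by (rule commute_jY_imp_jeval)
  then have X: "\<rho> jX = jscale \<gamma> jX + jeval g jY"
    by (simp add: algebra_simps)
  have "jphi \<gamma> g = \<rho>"
    unfolding jphi_def using assms X Y by (intro the1_equality jphi_unique \<gamma>(1)) simp
  then show thesis using that \<gamma>(1) by blast
qed

section \<open>The isotropy condition for inner derivations\<close>

lemma jphi_in_jaut: "\<gamma> \<noteq> 0 \<Longrightarrow> jphi \<gamma> g \<in> jaut"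
  and jphi_jX: "\<gamma> \<noteq> 0 \<Longrightarrow> jphi \<gamma> g jX = jscale \<gamma> jX + jeval g jY"
  and jphi_jY: "\<gamma> \<noteq> 0 \<Longrightarrow> jphi \<gamma> g jY = jscale \<gamma> jY"
  using theI'[OF jphi_unique, of \<gamma> g] by (simp_all add: jphi_def)

text \<open>Conjugation by \<rho> turns \<open>ad w\<close> into \<open>ad (\<rho> w)\<close>, and
  two inner derivations agree iff their elements differ by a central one, that is, by a
  scalar.\<close>

lemma isotropy_ad_iff:
  fixes \<rho> :: "'k::field_char_0 jordanian_plane \<Rightarrow> 'k jordanian_plane"
  assumes "\<rho> \<in> jaut"
  shows "\<rho> \<in> isotropy (ad w) \<longleftrightarrow> (\<exists>c. \<rho> w = w + jscale c 1)"
proof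
  have hom: "jalgebra_hom \<rho>" and "bij \<rho>"
    using assms by (auto simp: jaut_def)
  note \<rho> = jalgebra_homD[OF hom]
  show "\<exists>c. \<rho> w = w + jscale c 1" if "\<rho> \<in> isotropy (ad w)"
  proof -
    have "(\<rho> w - w) * b = b * (\<rho> w - w)" for b
    proof -
      obtain a where a: "\<rho> a = b" using \<open>bij \<rho>\<close> by (metis bij_pointE)
      have "\<rho> (ad w a) = ad w (\<rho> a)"
        using that by (auto simp: isotropy_def fun_eq_iff)
      then show ?thesis by (simp add: ad_def \<rho> a algebra_simps)
    qed
    then obtain c where "\<rho> w - w = jscale c 1" by (rule central_imp_scalar)
    then show ?thesis by (metis add.commute diff_add_cancel)
  qed
  show "\<rho> \<in> isotropy (ad w)" if "\<exists>c. \<rho> w = w + jscale c 1"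
    using that assms
    by (auto simp: isotropy_def fun_eq_iff ad_def \<rho> distrib_left distrib_right jscale_simps)
qed

lemma jscale_power: "(jscale c a) ^ n = jscale (c ^ n) (a ^ n)"
  by (induction n) (simp_all add: jscale_simps mult.commute)

lemma jphi_in_isotropy_iff:
  fixes \<gamma> :: "'k::field_char_0"
  assumes "\<gamma> \<noteq> 0"
  shows "jphi \<gamma> g \<in> isotropy (ad (jX ^ m * jY ^ n)) \<longleftrightarrow>
    (\<exists>c. (jscale \<gamma> jX + jeval g jY) ^ m * jscale (\<gamma> ^ n) (jY ^ n) = jX ^ m * jY ^ n + jscale c 1)"
proof -
  have "jalgebra_hom (jphi \<gamma> g)"
    using jphi_in_jaut[OF assms] by (simp add: jaut_def)
  then have "jphi \<gamma> g (jX ^ m * jY ^ n)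
      = (jscale \<gamma> jX + jeval g jY) ^ m * jscale (\<gamma> ^ n) (jY ^ n)"
    by (simp add: jalgebra_homD jphi_jX jphi_jY assms jscale_power)
  then show ?thesis by (simp add: isotropy_ad_iff jphi_in_jaut assms)
qed

text \<open>In the induction the derivative term of \<open>subcoeff_jcoord_mult\<close> vanishes,
  since the leading coefficient \<gamma>^m is constant in y. For m = 0 the truncated exponent
  \<open>m - 1\<close> is harmless because \<open>of_nat m\<close> is 0.\<close>

lemma jcoord_linear_power:
  fixes \<gamma> :: "'k::field" and g
  defines "h \<equiv> \<lambda>m. jcoord ((jscale \<gamma> jX + jeval g jY) ^ m)"
  shows "degree (h m) \<le> m \<and> coeff (h m) m = [:\<gamma> ^ m:]
    \<and> coeff (pCons 0 (h m)) m = [:of_nat m * \<gamma> ^ (m - 1):] * g"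
proof (induction m)
  case 0
  show ?case by (simp add: h_def jcoord_one)
next
  case (Suc m)
  let ?a = "jscale \<gamma> jX + jeval g jY"
  have a: "jcoord ?a = [:g, [:\<gamma>:]:]"
    by (simp add: jcoord_add jcoord_jscale jcoord_jX jcoord_jeval)
  have deg: "degree (jcoord (?a ^ m)) \<le> m" "degree (jcoord ?a) \<le> 1"
    using Suc.IH by (simp_all add: h_def a)
  have h: "h (Suc m) = jcoord (?a ^ m * ?a)"
    by (simp add: h_def power_commutes)
  have "coeff (pCons 0 (h (Suc m))) (m + 1)
      = [:\<gamma> ^ m:] * g + [:of_nat m * \<gamma> ^ (m - 1):] * g * [:\<gamma>:]"
    unfolding h using Suc.IH subcoeff_jcoord_mult[OF deg] by (simp add: h_def a pderiv_pCons)
  also have "\<dots> = [:of_nat (Suc m) * \<gamma> ^ m:] * g"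
  proof -
    have "[:\<gamma> ^ m:] * g + [:of_nat m * \<gamma> ^ (m - 1):] * g * [:\<gamma>:]
        = [:\<gamma> ^ m + of_nat m * \<gamma> ^ (m - 1) * \<gamma>:] * g"
      by (simp add: smult_add_left mult.commute)
    also have "\<gamma> ^ m + of_nat m * \<gamma> ^ (m - 1) * \<gamma> = of_nat (Suc m) * \<gamma> ^ m"
      by (cases m) (simp_all add: algebra_simps)
    finally show ?thesis .
  qed
  finally have "coeff (pCons 0 (h (Suc m))) (Suc m) = [:of_nat (Suc m) * \<gamma> ^ m:] * g"
    by simp
  moreover have "coeff (h (Suc m)) (Suc m) = [:\<gamma> ^ Suc m:]"
    unfolding h using Suc.IH coeff_jcoord_mult[OF deg] by (simp add: h_def a mult.commute)
  moreover have "degree (h (Suc m)) \<le> Suc m"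
    unfolding h using degree_jcoord_mult_le[OF deg] by simp
  ultimately show ?case by simp
qed

lemma jY_power: "jY ^ n = jeval (monom 1 n) jY"
  by (induction n) (simp_all add: monom_0 monom_Suc jeval_pCons jeval_0 jscale_simps)

text \<open>Comparison of the coefficients of x^m and x^(m-1). The constant c enters the first
  equation only for m = 0 and the second only for m = 1; for m = 0 the second reads 0 = 0.\<close>

lemma linear_power_eqD:
  fixes \<gamma> :: "'k::field"
  assumes eq: "(jscale \<gamma> jX + jeval g jY) ^ m * jscale (\<gamma> ^ n) (jY ^ n)
    = jX ^ m * jY ^ n + jscale c 1"
  shows "monom (\<gamma> ^ n) n * [:\<gamma> ^ m:] = monom 1 n + coeff [:[:c:]:] m"
    and "monom (\<gamma> ^ n) n * ([:of_nat m * \<gamma> ^ (m - 1):] * g) = coeff (pCons 0 [:[:c:]:]) m"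
proof -
  let ?h = "jcoord ((jscale \<gamma> jX + jeval g jY) ^ m)"
  have "jscale (\<gamma> ^ n) (jY ^ n) = jeval (monom (\<gamma> ^ n) n) jY"
    by (simp add: jY_power smult_monom flip: jeval_smult)
  with arg_cong[OF eq, of jcoord]
  have *: "smult (monom (\<gamma> ^ n) n) ?h = smult (monom 1 n) (jcoord (jX ^ m)) + [:[:c:]:]"
    by (simp add: jcoord_mult jcoord_add jcoord_jscale jcoord_one jY_power jact_jeval one_pCons)
  note h = jcoord_linear_power[where m = m]
  \<comment> \<open>The coefficients of x^m itself are the case \<gamma> = 1, g = 0.\<close>
  have X: "coeff (jcoord (jX ^ m)) m = (1 :: 'k poly)"
      "coeff (pCons 0 (jcoord (jX ^ m))) m = (0 :: 'k poly)"
    using h[of "1 :: 'k" 0] by (simp_all add: jeval_0 jscale_simps one_pCons)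
  show "monom (\<gamma> ^ n) n * [:\<gamma> ^ m:] = monom 1 n + coeff [:[:c:]:] m"
    using arg_cong[OF *, of "\<lambda>f. coeff f m"] h[of \<gamma> g] by (simp add: X del: mult_pCons_right)
  have "monom (\<gamma> ^ n) n * coeff (pCons 0 ?h) m
      = monom 1 n * coeff (pCons 0 (jcoord (jX ^ m))) m + coeff (pCons 0 [:[:c:]:]) m"
    using * by (cases m) (simp_all flip: coeff_smult)
  then show "monom (\<gamma> ^ n) n * ([:of_nat m * \<gamma> ^ (m - 1):] * g) = coeff (pCons 0 [:[:c:]:]) m"
    using h[of \<gamma> g] by (simp only: X) simp
qed

text \<open>By \<open>jaut_cases\<close> every automorphism is some \<open>jphi\<close>, so it is
  enough to decide membership on this family.\<close>

lemma isotropy_eqI: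
  fixes w :: "'k::field_char_0 jordanian_plane"
  assumes "\<And>\<gamma> g. \<gamma> \<noteq> 0 \<Longrightarrow> jphi \<gamma> g \<in> isotropy (ad w) \<longleftrightarrow> P \<gamma> g"
  shows "isotropy (ad w) = {jphi \<gamma> g | \<gamma> g. \<gamma> \<noteq> 0 \<and> P \<gamma> g}"
proof (intro equalityI subsetI)
  fix \<rho> assume \<rho>: "\<rho> \<in> isotropy (ad w)"
  then have "\<rho> \<in> jaut" by (simp add: isotropy_def)
  then obtain \<gamma> g where "\<gamma> \<noteq> 0" "\<rho> = jphi \<gamma> g" by (rule jaut_cases)
  with \<rho> assms show "\<rho> \<in> {jphi \<gamma> g | \<gamma> g. \<gamma> \<noteq> 0 \<and> P \<gamma> g}" by blast
qed (use assms in blast)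

theorem proposition21:
  fixes m n :: nat
    and w :: "'k::{alg_closed_field, field_char_0} jordanian_plane"
    and \<delta> :: "'k jordanian_plane \<Rightarrow> 'k jordanian_plane"
  assumes "w = jX ^ m * jY ^ n" and "\<delta> = ad w"
  shows "(m = 0 \<and> n = 0 \<longrightarrow> \<delta> = (\<lambda>a. 0) \<and> isotropy \<delta> = jaut)
    \<and> (m = 0 \<and> n > 0 \<longrightarrow> isotropy \<delta> = {jphi \<gamma> g | \<gamma> g. \<gamma> \<noteq> 0 \<and> \<gamma> ^ n = 1})
    \<and> (m = 1 \<and> n = 0 \<longrightarrow> isotropy \<delta> = {jphi 1 [:c:] | c. True})
    \<and> (m \<ge> 1 \<and> (m, n) \<noteq> (1, 0) \<longrightarrow> isotropy \<delta> = {jphi \<gamma> 0 | \<gamma>. \<gamma> \<noteq> 0 \<and> \<gamma> ^ (m + n) = 1})"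
proof (intro conjI impI; (elim conjE)?)
  note iff = jphi_in_isotropy_iff[where 'k = 'k and m = m and n = n, folded assms(1), folded assms(2)]
  note eqI = isotropy_eqI[of w, folded assms(2)]
  {
    assume "m = 0" "n = 0"
    then show "\<delta> = (\<lambda>a. 0)" by (simp add: assms ad_def fun_eq_iff)
    then show "isotropy \<delta> = jaut"
      by (auto simp: isotropy_def jaut_def fun_eq_iff jalgebra_homD)
  next
    assume mn: "m = 0" "n > 0"
    show "isotropy \<delta> = {jphi \<gamma> g | \<gamma> g. \<gamma> \<noteq> 0 \<and> \<gamma> ^ n = 1}"
    proof (rule eqI)
      fix \<gamma> :: 'k and g
      assume \<gamma>: "\<gamma> \<noteq> 0"
      \<comment> \<open>Compare coefficients of y^n: as n > 0, the constant c does not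
        interfere.\<close>
      have "\<gamma> ^ n = 1"
        if "(jscale \<gamma> jX + jeval g jY) ^ m * jscale (\<gamma> ^ n) (jY ^ n) = w + jscale c 1" for c
        using arg_cong[OF linear_power_eqD(1)[OF that[unfolded assms(1)]], of "\<lambda>p. coeff p n"] mn
        by (simp add: coeff_pCons split: nat.splits)
      moreover have "(jscale \<gamma> jX + jeval g jY) ^ m * jscale (\<gamma> ^ n) (jY ^ n) = w + jscale 0 1"
        if "\<gamma> ^ n = 1"
        using that mn by (simp add: assms(1) jscale_simps)
      ultimately show "jphi \<gamma> g \<in> isotropy \<delta> \<longleftrightarrow> \<gamma> ^ n = 1"
        unfolding iff[OF \<gamma>] by blast
    qed
  next
    assume mn: "m = 1" "n = 0"
    have "isotropy \<delta> = {jphi \<gamma> g | \<gamma> g. \<gamma> \<noteq> 0 \<and> (\<gamma> = 1 \<and> (\<exists>c. g = [:c:]))}"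
    proof (rule eqI)
      fix \<gamma> :: 'k and g
      assume \<gamma>: "\<gamma> \<noteq> 0"
      \<comment> \<open>Here the coefficient of x gives \<gamma> = 1 and the one of x^0 gives g =
        c.\<close>
      have "\<gamma> = 1 \<and> g = [:c:]"
        if "(jscale \<gamma> jX + jeval g jY) ^ m * jscale (\<gamma> ^ n) (jY ^ n) = w + jscale c 1" for c
        using linear_power_eqD[OF that[unfolded assms(1)]] mn by (simp add: monom_0)
      moreover have "(jscale \<gamma> jX + jeval g jY) ^ m * jscale (\<gamma> ^ n) (jY ^ n) = w + jscale c 1"
        if "\<gamma> = 1" "g = [:c:]" for c
        using that mn by (simp add: assms(1) jscale_simps jeval_pCons jeval_0)
      ultimately show "jphi \<gamma> g \<in> isotropy \<delta> \<longleftrightarrow> \<gamma> = 1 \<and> (\<exists>c. g = [:c:])"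
        unfolding iff[OF \<gamma>] by blast
    qed
    then show "isotropy \<delta> = {jphi 1 [:c:] | c. True}" by force
  next
    assume mn: "m \<ge> 1" "(m, n) \<noteq> (1, 0)"
    have "isotropy \<delta> = {jphi \<gamma> g | \<gamma> g. \<gamma> \<noteq> 0 \<and> (\<gamma> ^ (m + n) = 1 \<and> g = 0)}"
    proof (rule eqI)
      fix \<gamma> :: 'k and g
      assume \<gamma>: "\<gamma> \<noteq> 0"
      have "\<gamma> ^ (m + n) = 1 \<and> g = 0"
        if "(jscale \<gamma> jX + jeval g jY) ^ m * jscale (\<gamma> ^ n) (jY ^ n) = w + jscale c 1" for c
      proof
        note eqs = linear_power_eqD[OF that[unfolded assms(1)]]
        \<comment> \<open>Since m \<ge> 1, the constant c does not reach the coefficient of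
          x^m.\<close>
        have "coeff [:[:c:]:] m = 0" using mn by (simp add: coeff_pCons split: nat.split)
        with arg_cong[OF eqs(1), of "\<lambda>p. coeff p n"] show "\<gamma> ^ (m + n) = 1"
          by (simp add: power_add)
        show "g = 0"
        proof (rule ccontr)
          assume "g \<noteq> 0"
          \<comment> \<open>The factor of g in the subleading equation, a multiple of y^n that is
            nonzero in characteristic zero.\<close>
          define k where "k = monom (\<gamma> ^ n) n * [:of_nat m * \<gamma> ^ (m - 1):]"
          have k: "k = monom (of_nat m * \<gamma> ^ (m - 1) * \<gamma> ^ n) n"
            by (simp add: k_def smult_monom)
          have nz: "of_nat m * \<gamma> ^ (m - 1) * \<gamma> ^ n \<noteq> 0" using mn \<gamma> by simp
          then have "k \<noteq> 0" by (simp add: k)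
          have kg: "k * g = coeff (pCons 0 [:[:c:]:]) m"
            using eqs(2) by (simp only: k_def mult.assoc)
          \<comment> \<open>For m > 1 the right side would be 0, while \<open>k * g\<close> is
            nonzero.\<close>
          have "m = 1"
            using kg \<open>k \<noteq> 0\<close> \<open>g \<noteq> 0\<close> mn by (auto simp: coeff_pCons split: nat.splits)
          \<comment> \<open>Now \<open>k * g\<close> is the constant c, so k has degree 0 in y; this
            means n = 0, the excluded pair (1, 0).\<close>
          then have "degree (k * g) = 0" by (simp add: kg)
          then have "degree k = 0"
            using \<open>k \<noteq> 0\<close> \<open>g \<noteq> 0\<close> by (simp add: degree_mult_eq)
          then show False using nz mn \<open>m = 1\<close> by (simp add: k degree_monom_eq)
        qed
      qed
      moreover have "(jscale \<gamma> jX + jeval g jY) ^ m * jscale (\<gamma> ^ n) (jY ^ n) = w + jscale 0 1"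
        if "\<gamma> ^ (m + n) = 1" "g = 0"
      proof -
        have "\<gamma> ^ n * \<gamma> ^ m = 1" using that(1) by (simp add: power_add mult.commute)
        then show ?thesis
          by (simp add: assms(1) that(2) jeval_0 jscale_power jscale_simps)
      qed
      ultimately show "jphi \<gamma> g \<in> isotropy \<delta> \<longleftrightarrow> \<gamma> ^ (m + n) = 1 \<and> g = 0"
        unfolding iff[OF \<gamma>] by blast
    qed
    then show "isotropy \<delta> = {jphi \<gamma> 0 | \<gamma>. \<gamma> \<noteq> 0 \<and> \<gamma> ^ (m + n) = 1}" by blast
  }
qed

end
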